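(* Let $R$ be a commutative ring with identity and $S$ a multiplicative subset of $R$. Let $0\to A\to B\to C\to 0$ be a $u$-$S$-exact sequence of $R$-modules. Then $B$ is $u$-$S$-Noetherian if and only if $A$ and $C$ are $u$-$S$-Noetherian.
   Context: A subset $S$ of $R$ is multiplicative if $1\in S$ and $s_1s_2\in S$ for all $s_1,s_2\in S$. An $R$-module $M$ is $u$-$S$-Noetherian if there exists $s\in S$ such that for every submodule $N$ of $M$ there is a finitely generated submodule $F\subseteq N$ with $sN\subseteq F$. A sequence of $R$-modules $M\xrightarrow{f}N\xrightarrow{g}L$ is $u$-$S$-exact (at $N$) if there is $s\in S$ with $s\,\mathrm{Ker}(g)\subseteq \mathrm{Im}(f)$ and $s\,\mathrm{Im}(f)\subseteq \mathrm{Ker}(g)$; a longer sequence is $u$-$S$-exact if it is $u$-$S$-exact at each inner term. *)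

theory Defs
  imports "HOL-Algebra.Module" "HOL-Algebra.AbelCoset" "HOL.Hull"
begin

text \<open>
  Multiplicative subsets of a ring \<open>R\<close> are \<open>submonoid S R\<close>, i.e. submonoids of the multiplicative
  monoid of \<open>R\<close>. Neither \<open>\<zero> \<notin> S\<close> nor \<open>\<one> \<noteq> \<zero>\<close> is required.
\<close>

definition mod_hom ::
    "('r, 'x) ring_scheme \<Rightarrow> ('r, 'a, 'y) module_scheme \<Rightarrow> ('r, 'b, 'z) module_scheme \<Rightarrow> ('a \<Rightarrow> 'b) set"
  where "mod_hom R M N =
    {h \<in> hom (add_monoid M) (add_monoid N).
      \<forall>r\<in>carrier R. \<forall>x\<in>carrier M. h (r \<odot>\<^bsub>M\<^esub> x) = r \<odot>\<^bsub>N\<^esub> h x}"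

definition fg_submodule ::
    "'a set \<Rightarrow> ('r, 'x) ring_scheme \<Rightarrow> ('r, 'a, 'y) module_scheme \<Rightarrow> bool"
  where "fg_submodule F R M \<longleftrightarrow>
    submodule F R M \<and>
    (\<exists>X. finite X \<and> X \<subseteq> carrier M \<and> F = (\<lambda>N. submodule N R M) hull X)"

definition u_S_Noetherian ::
    "('r, 'x) ring_scheme \<Rightarrow> 'r set \<Rightarrow> ('r, 'a, 'y) module_scheme \<Rightarrow> bool"
  where "u_S_Noetherian R S M \<longleftrightarrow>
    (\<exists>s\<in>S. \<forall>N. submodule N R M \<longrightarrow>
      (\<exists>F. fg_submodule F R M \<and> F \<subseteq> N \<and> (\<lambda>x. s \<odot>\<^bsub>M\<^esub> x) ` N \<subseteq> F))"

text \<open>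
  Exactness at \<open>N\<close> of the sequence \<open>M \<rightarrow> N \<rightarrow> L\<close> with maps \<open>f\<close> and \<open>g\<close>. That \<open>f\<close> and \<open>g\<close> are
  homomorphisms of modules is not part of this predicate.
\<close>

definition u_S_exact ::
    "('r, 'x) ring_scheme \<Rightarrow> 'r set \<Rightarrow> ('r, 'a, 'w) module_scheme \<Rightarrow> ('a \<Rightarrow> 'b) \<Rightarrow>
      ('r, 'b, 'y) module_scheme \<Rightarrow> ('b \<Rightarrow> 'c) \<Rightarrow> ('r, 'c, 'z) module_scheme \<Rightarrow> bool"
  where "u_S_exact R S M f N g L \<longleftrightarrow>
    (\<exists>s\<in>S. (\<lambda>x. s \<odot>\<^bsub>N\<^esub> x) ` a_kernel N L g \<subseteq> f ` carrier M \<and>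
           (\<lambda>x. s \<odot>\<^bsub>N\<^esub> x) ` (f ` carrier M) \<subseteq> a_kernel N L g)"

definition zero_module :: "('r, unit) module"
  where "zero_module =
    \<lparr>carrier = {()}, mult = (\<lambda>_ _. ()), one = (), zero = (), add = (\<lambda>_ _. ()),
     smult = (\<lambda>_ _. ())\<rparr>"

lemma module_zero_module:
  assumes "cring R"
  shows "module R zero_module"
  by (intro moduleI abelian_groupI assms) (simp_all add: zero_module_def)

text \<open>
  The sequence \<open>0 \<rightarrow> A \<rightarrow> B \<rightarrow> C \<rightarrow> 0\<close>; each inner term may have its own element of \<open>S\<close>.
\<close>

definition u_S_short_exact ::
    "('r, 'x) ring_scheme \<Rightarrow> 'r set \<Rightarrow> ('r, 'a, 'w) module_scheme \<Rightarrow> ('a \<Rightarrow> 'b) \<Rightarrow>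
      ('r, 'b, 'y) module_scheme \<Rightarrow> ('b \<Rightarrow> 'c) \<Rightarrow> ('r, 'c, 'z) module_scheme \<Rightarrow> bool"
  where "u_S_short_exact R S A f B g C \<longleftrightarrow>
    u_S_exact R S zero_module (\<lambda>_. \<zero>\<^bsub>A\<^esub>) A f B \<and>
    u_S_exact R S A f B g C \<and>
    u_S_exact R S B g C (\<lambda>_. ()) zero_module"

end

theory Submission
  imports Defs
begin

text \<open>
  The classical argument works with denominators tracked: at each step where exactness, injectivity
  or surjectivity is needed, one multiplies by the element of \<open>S\<close> by which it holds, and these
  elements do not depend on the submodule considered. For the extension step, if \<open>c\<close> and \<open>a\<close> are
  the uniform elements for \<open>C\<close> and \<open>A\<close> and \<open>s\<close> carries \<open>Ker g\<close> into \<open>Im f\<close>, then \<open>a s c\<close> is one for \<open>B\<close>.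
\<close>

abbreviation submodule_span ::
    "('r, 'x) ring_scheme \<Rightarrow> ('r, 'a, 'y) module_scheme \<Rightarrow> 'a set \<Rightarrow> 'a set"
  where "submodule_span R M X \<equiv> (\<lambda>N. submodule N R M) hull X"

section \<open>Submodules, spans, and the Noetherian condition via finite generating sets\<close>

context module
begin

lemma submodule_minus:
  assumes "submodule H R M" "x \<in> H" "y \<in> H"
  shows "x \<ominus>\<^bsub>M\<^esub> y \<in> H"
  using submoduleE[OF assms(1)] assms(2,3) by (simp add: a_minus_def)

lemma smult_minus_distr:
  assumes "a \<in> carrier R" "x \<in> carrier M" "y \<in> carrier M"
  shows "a \<odot>\<^bsub>M\<^esub> (x \<ominus>\<^bsub>M\<^esub> y) = a \<odot>\<^bsub>M\<^esub> x \<ominus>\<^bsub>M\<^esub> a \<odot>\<^bsub>M\<^esub> y"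
  using assms by (simp add: a_minus_def smult_r_distr smult_r_minus)

lemma minus_zero_imp_eq:
  assumes "x \<in> carrier M" "y \<in> carrier M" "x \<ominus>\<^bsub>M\<^esub> y = \<zero>\<^bsub>M\<^esub>"
  shows "x = y"
proof -
  have "x = (x \<ominus>\<^bsub>M\<^esub> y) \<oplus>\<^bsub>M\<^esub> y"
    using assms(1,2) by (simp add: a_minus_def M.a_assoc M.l_neg)
  with assms show ?thesis by simp
qed

lemma submodule_zero:
  assumes "submodule H R M"
  shows "\<zero>\<^bsub>M\<^esub> \<in> H"
  using subgroup.one_closed[OF submodule.axioms(1)[OF assms]] by simp

text \<open>The hull is the intersection of all submodules containing \<open>X\<close>. Since
  \<open>X\<close> lies in the carrier, the carrier is one of them; otherwise the family would be
  empty and its intersection the whole type.\<close>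

lemma submodule_span:
  assumes "X \<subseteq> carrier M"
  shows "submodule (submodule_span R M X) R M"
proof (rule submoduleI)
  show "submodule_span R M X \<subseteq> carrier M"
    using assms carrier_is_submodule by (rule hull_minimal)
qed (auto simp: hull_def submodule_zero submoduleE(3-5))

text \<open>A finitely generated \<open>F\<close> is traded for a finite generating set
  \<open>X\<close>, because generators can be mapped forward and lifted along homomorphisms. The
  condition \<open>F \<subseteq> N\<close> becomes \<open>X \<subseteq> N\<close>, as a span is the
  least submodule containing its generators.\<close>

lemma u_S_Noetherian_iff:
  "u_S_Noetherian R S M \<longleftrightarrow>
    (\<exists>s\<in>S. \<forall>N. submodule N R M \<longrightarrow>
      (\<exists>X. finite X \<and> X \<subseteq> N \<and> (\<forall>n\<in>N. s \<odot>\<^bsub>M\<^esub> n \<in> submodule_span R M X)))"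
proof -
  have "(\<exists>F. fg_submodule F R M \<and> F \<subseteq> N \<and> (\<lambda>x. s \<odot>\<^bsub>M\<^esub> x) ` N \<subseteq> F) \<longleftrightarrow>
        (\<exists>X. finite X \<and> X \<subseteq> N \<and> (\<forall>n\<in>N. s \<odot>\<^bsub>M\<^esub> n \<in> submodule_span R M X))"
    (is "?L \<longleftrightarrow> ?R") if N: "submodule N R M" for N s
  proof
    assume ?L
    then show ?R
      unfolding fg_submodule_def by (metis hull_subset image_subset_iff order_trans)
  next
    assume ?R
    then obtain X where X: "finite X" "X \<subseteq> N" "\<forall>n\<in>N. s \<odot>\<^bsub>M\<^esub> n \<in> submodule_span R M X"
      by blast
    have "X \<subseteq> carrier M"
      using X(2) submoduleE(1)[OF N] by blast
    with X(1) have "fg_submodule (submodule_span R M X) R M"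
      unfolding fg_submodule_def using submodule_span by blast
    moreover have "submodule_span R M X \<subseteq> N"
      using X(2) N by (rule hull_minimal)
    ultimately show ?L
      using X(3) by blast
  qed
  then show ?thesis
    unfolding u_S_Noetherian_def by (metis (no_types, lifting))
qed

lemma u_S_NoetherianI:
  assumes "s \<in> S"
    and "\<And>N. submodule N R M \<Longrightarrow>
      \<exists>X. finite X \<and> X \<subseteq> N \<and> (\<forall>n\<in>N. s \<odot>\<^bsub>M\<^esub> n \<in> submodule_span R M X)"
  shows "u_S_Noetherian R S M"
  unfolding u_S_Noetherian_iff
  by (rule bexI[OF _ assms(1)]) (intro allI impI assms(2))

lemma u_S_NoetherianE:
  assumes "u_S_Noetherian R S M"
  obtains s where "s \<in> S" "\<And>N. submodule N R M \<Longrightarrow>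
      \<exists>X. finite X \<and> X \<subseteq> N \<and> (\<forall>n\<in>N. s \<odot>\<^bsub>M\<^esub> n \<in> submodule_span R M X)"
proof -
  from assms obtain s where "s \<in> S" and s: "\<forall>N. submodule N R M \<longrightarrow>
      (\<exists>X. finite X \<and> X \<subseteq> N \<and> (\<forall>n\<in>N. s \<odot>\<^bsub>M\<^esub> n \<in> submodule_span R M X))"
    unfolding u_S_Noetherian_iff by (elim bexE)
  then show thesis
    by (intro that[OF _ s[rule_format]])
qed

end

section \<open>Homomorphisms and transfer of the Noetherian condition along them\<close>

locale module_homomorphism = M: module R M + N: module R N
  for R (structure) and M (structure) and N (structure) +
  fixes h
  assumes hom_mem: "h \<in> mod_hom R M N"
begin

lemma closed [simp]: "x \<in> carrier M \<Longrightarrow> h x \<in> carrier N"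
  using hom_mem by (auto simp: mod_hom_def hom_def)

lemma add: "x \<in> carrier M \<Longrightarrow> y \<in> carrier M \<Longrightarrow> h (x \<oplus>\<^bsub>M\<^esub> y) = h x \<oplus>\<^bsub>N\<^esub> h y"
  using hom_mem by (auto simp: mod_hom_def hom_def)

lemma smult: "r \<in> carrier R \<Longrightarrow> x \<in> carrier M \<Longrightarrow> h (r \<odot>\<^bsub>M\<^esub> x) = r \<odot>\<^bsub>N\<^esub> h x"
  using hom_mem by (auto simp: mod_hom_def)

lemma zero: "h \<zero>\<^bsub>M\<^esub> = \<zero>\<^bsub>N\<^esub>"
  using smult[of \<zero> "\<zero>\<^bsub>M\<^esub>"] by simp

lemma neg: "x \<in> carrier M \<Longrightarrow> h (\<ominus>\<^bsub>M\<^esub> x) = \<ominus>\<^bsub>N\<^esub> h x"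
  using smult[of "\<ominus> \<one>" x] by (simp add: M.smult_l_minus N.smult_l_minus)

lemma minus: "x \<in> carrier M \<Longrightarrow> y \<in> carrier M \<Longrightarrow> h (x \<ominus>\<^bsub>M\<^esub> y) = h x \<ominus>\<^bsub>N\<^esub> h y"
  by (simp add: a_minus_def add neg)

lemma diff_in_kernel:
  assumes "x \<in> carrier M" "y \<in> carrier M" "h x = h y"
  shows "x \<ominus>\<^bsub>M\<^esub> y \<in> a_kernel M N h"
  using assms minus[OF assms(1,2)] N.M.r_neg[of "h y"]
  by (simp add: a_kernel_def' a_minus_def)

lemma submodule_image:
  assumes "submodule H R M"
  shows "submodule (h ` H) R N"
proof (rule N.submoduleI)
  note H = M.submoduleE[OF assms]
  show "h ` H \<subseteq> carrier N"
    using H(1) by auto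
  show "\<zero>\<^bsub>N\<^esub> \<in> h ` H"
    using M.submodule_zero[OF assms] zero by (metis image_eqI)
  show "\<ominus>\<^bsub>N\<^esub> a \<in> h ` H" if "a \<in> h ` H" for a
    using that H(1,3) by (auto simp: subset_iff neg[symmetric])
  show "a \<oplus>\<^bsub>N\<^esub> b \<in> h ` H" if "a \<in> h ` H" "b \<in> h ` H" for a b
    using that H(1,5) by (auto simp: subset_iff add[symmetric])
  show "r \<odot>\<^bsub>N\<^esub> x \<in> h ` H" if "r \<in> carrier R" "x \<in> h ` H" for r x
    using that H(1,4) by (auto simp: subset_iff smult[symmetric])
qed

lemma submodule_preimage:
  assumes "submodule K R N"
  shows "submodule {x \<in> carrier M. h x \<in> K} R M"
  by (rule M.submoduleI)
    (use N.submoduleE(3-5)[OF assms] N.submodule_zero[OF assms]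
      in \<open>simp_all add: zero neg add smult subset_iff\<close>)

text \<open>Both inclusions come from minimality of spans: the preimage of the span of
  \<open>h\<close>
  X\<open>is a submodule containing\<close>X\<open>, and the image of the span of\<close>X\<open>is a submodule containing\<close>h
  \<open>X\<close>.\<close>

lemma image_span:
  assumes "X \<subseteq> carrier M"
  shows "h ` submodule_span R M X = submodule_span R N (h ` X)"
proof
  have "h ` X \<subseteq> carrier N"
    using assms by auto
  then have "submodule {x \<in> carrier M. h x \<in> submodule_span R N (h ` X)} R M"
    by (intro submodule_preimage N.submodule_span)
  then have "submodule_span R M X \<subseteq> {x \<in> carrier M. h x \<in> submodule_span R N (h ` X)}"
    using assms by (intro hull_minimal) (auto intro: hull_inc)
  then show "h ` submodule_span R M X \<subseteq> submodule_span R N (h ` X)"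
    by blast
  show "submodule_span R N (h ` X) \<subseteq> h ` submodule_span R M X"
    using assms by (intro hull_minimal submodule_image M.submodule_span image_mono hull_subset)
qed

lemma u_S_Noetherian_domain:
  assumes "submonoid S R" "u_S_Noetherian R S N"
    and "s \<in> S" "\<And>x. x \<in> a_kernel M N h \<Longrightarrow> s \<odot>\<^bsub>M\<^esub> x = \<zero>\<^bsub>M\<^esub>"
  shows "u_S_Noetherian R S M"
proof -
  interpret S: submonoid S R by fact
  obtain t where t: "t \<in> S" "\<And>K. submodule K R N \<Longrightarrow>
      \<exists>X. finite X \<and> X \<subseteq> K \<and> (\<forall>n\<in>K. t \<odot>\<^bsub>N\<^esub> n \<in> submodule_span R N X)"
    using assms(2) by (rule N.u_S_NoetherianE) blast
  have st: "s \<in> carrier R" "t \<in> carrier R"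
    using assms(3) t(1) by auto
  have "\<exists>X. finite X \<and> X \<subseteq> H \<and> (\<forall>n\<in>H. (s \<otimes> t) \<odot>\<^bsub>M\<^esub> n \<in> submodule_span R M X)"
    if H: "submodule H R M" for H
  proof -
    obtain X where X: "finite X" "X \<subseteq> h ` H" "\<forall>n\<in>h ` H. t \<odot>\<^bsub>N\<^esub> n \<in> submodule_span R N X"
      using t(2)[OF submodule_image[OF H]] by blast
    \<comment> \<open>One lift in \<open>H\<close> is chosen for each generator, so finiteness is
      kept.\<close>
    obtain Y where Y: "finite Y" "Y \<subseteq> H" "X = h ` Y"
      using finite_subset_image[OF X(1,2)] by blast
    have Hc: "H \<subseteq> carrier M"
      using M.submoduleE(1)[OF H] .
    with Y(2) have Yc: "Y \<subseteq> carrier M" by blast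
    note span = M.submodule_span[OF Yc]
    have "(s \<otimes> t) \<odot>\<^bsub>M\<^esub> n \<in> submodule_span R M Y" if n: "n \<in> H" for n
    proof -
      have nc: "n \<in> carrier M" using n Hc by blast
      have "h (t \<odot>\<^bsub>M\<^esub> n) \<in> h ` submodule_span R M Y"
        using X(3) n nc st by (simp add: smult image_span[OF Yc] Y(3))
      then obtain y where y: "y \<in> submodule_span R M Y" "h (t \<odot>\<^bsub>M\<^esub> n) = h y"
        by blast
      have yc: "y \<in> carrier M" using y(1) M.submoduleE(1)[OF span] by blast
      \<comment> \<open>The two terms have the same image under \<open>h\<close>, so their
        difference is in the kernel.\<close>
      have "s \<odot>\<^bsub>M\<^esub> (t \<odot>\<^bsub>M\<^esub> n \<ominus>\<^bsub>M\<^esub> y) = \<zero>\<^bsub>M\<^esub>"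
        by (intro assms(4) diff_in_kernel) (use y(2) yc nc st in simp_all)
      then have "s \<odot>\<^bsub>M\<^esub> (t \<odot>\<^bsub>M\<^esub> n) \<ominus>\<^bsub>M\<^esub> s \<odot>\<^bsub>M\<^esub> y = \<zero>\<^bsub>M\<^esub>"
        using yc nc st by (simp add: M.smult_minus_distr)
      then have "s \<odot>\<^bsub>M\<^esub> (t \<odot>\<^bsub>M\<^esub> n) = s \<odot>\<^bsub>M\<^esub> y"
        by (rule M.minus_zero_imp_eq[rotated 2]) (use yc nc st in simp_all)
      then show ?thesis
        using M.submoduleE(4)[OF span st(1) y(1)] nc st by (simp add: M.smult_assoc1)
    qed
    with Y show ?thesis by blast
  qed
  moreover have "s \<otimes> t \<in> S"
    using assms(3) t(1) by simp
  ultimately show ?thesis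
    by (intro M.u_S_NoetherianI)
qed

text \<open>A version of passing to a quotient, with surjectivity of \<open>h\<close> holding only
  after multiplication by \<open>s\<close>. For \<open>n\<close> in \<open>K\<close>, write
  \<open>s n = h m\<close>; then \<open>m\<close> lies in the preimage of \<open>K\<close>, and
  \<open>t s n = h (t m)\<close> lies in the span of the images of that preimage's
  generators.\<close>

lemma u_S_Noetherian_codomain:
  assumes "submonoid S R" "u_S_Noetherian R S M"
    and "s \<in> S" "\<And>y. y \<in> carrier N \<Longrightarrow> s \<odot>\<^bsub>N\<^esub> y \<in> h ` carrier M"
  shows "u_S_Noetherian R S N"
proof -
  interpret S: submonoid S R by fact
  obtain t where t: "t \<in> S" "\<And>H. submodule H R M \<Longrightarrow>
      \<exists>X. finite X \<and> X \<subseteq> H \<and> (\<forall>n\<in>H. t \<odot>\<^bsub>M\<^esub> n \<in> submodule_span R M X)"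
    using assms(2) by (rule M.u_S_NoetherianE) blast
  have st: "s \<in> carrier R" "t \<in> carrier R"
    using assms(3) t(1) by auto
  have "\<exists>X. finite X \<and> X \<subseteq> K \<and> (\<forall>n\<in>K. (t \<otimes> s) \<odot>\<^bsub>N\<^esub> n \<in> submodule_span R N X)"
    if K: "submodule K R N" for K
  proof -
    let ?H = "{x \<in> carrier M. h x \<in> K}"
    obtain X where X: "finite X" "X \<subseteq> ?H" "\<forall>n\<in>?H. t \<odot>\<^bsub>M\<^esub> n \<in> submodule_span R M X"
      using t(2)[OF submodule_preimage[OF K]] by blast
    have "(t \<otimes> s) \<odot>\<^bsub>N\<^esub> n \<in> submodule_span R N (h ` X)" if n: "n \<in> K" for n
    proof -
      have nc: "n \<in> carrier N" using n N.submoduleE(1)[OF K] by blast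
      then obtain m where m: "m \<in> carrier M" "s \<odot>\<^bsub>N\<^esub> n = h m"
        using assms(4) by blast
      have "m \<in> ?H"
        using m N.submoduleE(4)[OF K st(1) n] by simp
      then have "h (t \<odot>\<^bsub>M\<^esub> m) \<in> h ` submodule_span R M X"
        using X(3) by blast
      moreover have "X \<subseteq> carrier M" using X(2) by blast
      ultimately show ?thesis
        using m nc st by (simp add: image_span N.smult_assoc1 smult)
    qed
    then show ?thesis
      using X(1,2) by (intro exI[of _ "h ` X"]) auto
  qed
  moreover have "t \<otimes> s \<in> S"
    using assms(3) t(1) by simp
  ultimately show ?thesis
    by (intro N.u_S_NoetherianI)
qed

end

section \<open>Extensions, and the equivalence for short exact sequences\<close>

lemma u_S_exactE:
  assumes "u_S_exact R S M f N g L"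
  obtains s where "s \<in> S" "\<And>x. x \<in> a_kernel N L g \<Longrightarrow> s \<odot>\<^bsub>N\<^esub> x \<in> f ` carrier M"
proof -
  from assms obtain s where "s \<in> S" "(\<lambda>x. s \<odot>\<^bsub>N\<^esub> x) ` a_kernel N L g \<subseteq> f ` carrier M"
    unfolding u_S_exact_def by (elim bexE conjE)
  then show thesis
    by (intro that[of s]) (simp_all add: image_subset_iff)
qed

lemma u_S_Noetherian_extension:
  fixes R (structure)
  assumes "submonoid S R"
    and "module_homomorphism R A B f" "module_homomorphism R B C g"
    and "u_S_Noetherian R S A" "u_S_Noetherian R S C"
    and "s \<in> S" "\<And>x. x \<in> a_kernel B C g \<Longrightarrow> s \<odot>\<^bsub>B\<^esub> x \<in> f ` carrier A"
  shows "u_S_Noetherian R S B"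
proof -
  interpret S: submonoid S R by fact
  interpret f: module_homomorphism R A B f by fact
  interpret g: module_homomorphism R B C g by fact
  obtain a where a: "a \<in> S" "\<And>H. submodule H R A \<Longrightarrow>
      \<exists>X. finite X \<and> X \<subseteq> H \<and> (\<forall>n\<in>H. a \<odot>\<^bsub>A\<^esub> n \<in> submodule_span R A X)"
    using assms(4) by (rule f.M.u_S_NoetherianE) blast
  obtain c where c: "c \<in> S" "\<And>H. submodule H R C \<Longrightarrow>
      \<exists>X. finite X \<and> X \<subseteq> H \<and> (\<forall>n\<in>H. c \<odot>\<^bsub>C\<^esub> n \<in> submodule_span R C X)"
    using assms(5) by (rule g.N.u_S_NoetherianE) blast
  have sac: "s \<in> carrier R" "a \<in> carrier R" "c \<in> carrier R"
    using assms(6) a(1) c(1) by auto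
  have "\<exists>X. finite X \<and> X \<subseteq> H \<and>
      (\<forall>n\<in>H. (a \<otimes> s \<otimes> c) \<odot>\<^bsub>B\<^esub> n \<in> submodule_span R B X)"
    if H: "submodule H R B" for H
  proof -
    let ?K = "{x \<in> carrier A. f x \<in> H}"
    obtain X where X: "finite X" "X \<subseteq> ?K" "\<forall>n\<in>?K. a \<odot>\<^bsub>A\<^esub> n \<in> submodule_span R A X"
      using a(2)[OF f.submodule_preimage[OF H]] by blast
    obtain Z where Z: "finite Z" "Z \<subseteq> g ` H" "\<forall>n\<in>g ` H. c \<odot>\<^bsub>C\<^esub> n \<in> submodule_span R C Z"
      using c(2)[OF g.submodule_image[OF H]] by blast
    obtain Y where Y: "finite Y" "Y \<subseteq> H" "Z = g ` Y"
      using finite_subset_image[OF Z(1,2)] by blast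
    let ?X = "f ` X \<union> Y"
    have Hc: "H \<subseteq> carrier B"
      using f.N.submoduleE(1)[OF H] .
    have Xc: "X \<subseteq> carrier A" and XH: "?X \<subseteq> H" and Yc: "Y \<subseteq> carrier B"
      using X(2) Y(2) Hc by auto
    \<comment> \<open>This keeps the approximation \<open>y\<close> of \<open>c n\<close>, and hence
      the difference \<open>?d\<close>, inside \<open>H\<close>; only then does the \<open>x\<close>
      with \<open>f x = s ?d\<close> belong to \<open>?K\<close>.\<close>
    have YH: "submodule_span R B Y \<subseteq> H"
      using Y(2) H by (rule hull_minimal)
    have span: "submodule (submodule_span R B ?X) R B"
      using XH Hc by (intro f.N.submodule_span) blast
    have "(a \<otimes> s \<otimes> c) \<odot>\<^bsub>B\<^esub> n \<in> submodule_span R B ?X" if n: "n \<in> H" for n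
    proof -
      have nc: "n \<in> carrier B" using n Hc by blast
      have "g (c \<odot>\<^bsub>B\<^esub> n) \<in> g ` submodule_span R B Y"
        using Z(3) n nc sac by (simp add: g.smult g.image_span[OF Yc] Y(3))
      then obtain y where y: "y \<in> submodule_span R B Y" "g (c \<odot>\<^bsub>B\<^esub> n) = g y"
        by blast
      have yH: "y \<in> H" and yc: "y \<in> carrier B"
        using y(1) YH Hc by auto
      \<comment> \<open>The part of \<open>c n\<close> that \<open>g\<close> does not see: it lies
        in the kernel of \<open>g\<close>, so \<open>s\<close> carries it into the image of
        \<open>f\<close>.\<close>
      let ?d = "c \<odot>\<^bsub>B\<^esub> n \<ominus>\<^bsub>B\<^esub> y"
      have d: "?d \<in> H" "?d \<in> carrier B"
        using f.N.submodule_minus[OF H f.N.submoduleE(4)[OF H sac(3) n] yH] Hc by auto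
      have "?d \<in> a_kernel B C g"
        by (intro g.diff_in_kernel) (use y(2) yc nc sac in simp_all)
      then obtain x where x: "x \<in> carrier A" "s \<odot>\<^bsub>B\<^esub> ?d = f x"
        using assms(7) by blast
      have "x \<in> ?K"
        using x f.N.submoduleE(4)[OF H sac(1) d(1)] by simp
      then have "f (a \<odot>\<^bsub>A\<^esub> x) \<in> f ` submodule_span R A X"
        using X(3) by blast
      then have "(a \<otimes> s) \<odot>\<^bsub>B\<^esub> ?d \<in> submodule_span R B (f ` X)"
        using x sac d(2) by (simp add: f.image_span[OF Xc] f.smult f.N.smult_assoc1)
      then have "(a \<otimes> s) \<odot>\<^bsub>B\<^esub> ?d \<in> submodule_span R B ?X"
        using hull_mono[of "f ` X" ?X] by blast
      moreover have "(a \<otimes> s) \<odot>\<^bsub>B\<^esub> y \<in> submodule_span R B ?X"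
        using y(1) hull_mono[of Y ?X] sac by (intro f.N.submoduleE(4)[OF span]) auto
      \<comment> \<open>The first summand is controlled by \<open>A\<close>, the second by
        \<open>C\<close>; since \<open>c n = ?d + y\<close>, the sum is
        \<open>a s c n\<close>.\<close>
      ultimately have "(a \<otimes> s) \<odot>\<^bsub>B\<^esub> ?d \<oplus>\<^bsub>B\<^esub> (a \<otimes> s) \<odot>\<^bsub>B\<^esub> y \<in> submodule_span R B ?X"
        by (rule f.N.submoduleE(5)[OF span])
      then have "(a \<otimes> s) \<odot>\<^bsub>B\<^esub> (?d \<oplus>\<^bsub>B\<^esub> y) \<in> submodule_span R B ?X"
        using f.N.smult_r_distr[of "a \<otimes> s" ?d y] sac d(2) yc by simp
      moreover have "?d \<oplus>\<^bsub>B\<^esub> y = c \<odot>\<^bsub>B\<^esub> n"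
        using nc yc sac by (simp add: a_minus_def f.N.M.a_assoc f.N.M.l_neg)
      ultimately show ?thesis
        using nc sac f.N.smult_assoc1[of "a \<otimes> s" c n] by simp
    qed
    with X(1) Y(1) XH show ?thesis
      by (intro exI[of _ ?X]) auto
  qed
  moreover have "a \<otimes> s \<otimes> c \<in> S"
    using assms(6) a(1) c(1) by simp
  ultimately show ?thesis
    by (intro f.N.u_S_NoetherianI)
qed

theorem proposition2p13:
  fixes R :: "('r, 'x) ring_scheme"
    and S :: "'r set"
    and A :: "('r, 'a, 'u) module_scheme"
    and B :: "('r, 'b, 'v) module_scheme"
    and C :: "('r, 'c, 'w) module_scheme"
    and f :: "'a \<Rightarrow> 'b"
    and g :: "'b \<Rightarrow> 'c"
  assumes "cring R"
    and "submonoid S R"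
    and "module R A" and "module R B" and "module R C"
    and "f \<in> mod_hom R A B" and "g \<in> mod_hom R B C"
    and "u_S_short_exact R S A f B g C"
  shows "u_S_Noetherian R S B \<longleftrightarrow> u_S_Noetherian R S A \<and> u_S_Noetherian R S C"
proof -
  have f: "module_homomorphism R A B f" and g: "module_homomorphism R B C g"
    using assms by (simp_all add: module_homomorphism_def module_homomorphism_axioms_def)
  have exact: "u_S_exact R S zero_module (\<lambda>_. \<zero>\<^bsub>A\<^esub>) A f B" "u_S_exact R S A f B g C"
      "u_S_exact R S B g C (\<lambda>_. ()) zero_module"
    using assms(8) by (simp_all add: u_S_short_exact_def)
  \<comment> \<open>The map from the zero module has image zero, so exactness at \<open>A\<close>
    makes \<open>f\<close> injective up to \<open>s1\<close>.\<close>
  obtain s1 where s1: "s1 \<in> S" "\<And>x. x \<in> a_kernel A B f \<Longrightarrow> s1 \<odot>\<^bsub>A\<^esub> x = \<zero>\<^bsub>A\<^esub>"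
    using exact(1) by (rule u_S_exactE) blast
  obtain s2 where s2: "s2 \<in> S" "\<And>x. x \<in> a_kernel B C g \<Longrightarrow> s2 \<odot>\<^bsub>B\<^esub> x \<in> f ` carrier A"
    using exact(2) by (rule u_S_exactE) blast
  \<comment> \<open>The kernel of the map to the zero module is all of \<open>C\<close>, so
    exactness at \<open>C\<close> makes \<open>g\<close> surjective up to \<open>s3\<close>.\<close>
  have "carrier C \<subseteq> a_kernel C zero_module (\<lambda>_. ())"
    unfolding a_kernel_def' by (simp add: subset_iff zero_module_def)
  then obtain s3 where s3: "s3 \<in> S" "\<And>y. y \<in> carrier C \<Longrightarrow> s3 \<odot>\<^bsub>C\<^esub> y \<in> g ` carrier B"
    using exact(3) by (elim u_S_exactE) blast
  show ?thesis
  proof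
    assume B: "u_S_Noetherian R S B"
    show "u_S_Noetherian R S A \<and> u_S_Noetherian R S C"
      using module_homomorphism.u_S_Noetherian_domain[OF f assms(2) B s1]
        module_homomorphism.u_S_Noetherian_codomain[OF g assms(2) B s3] by (rule conjI)
  next
    assume "u_S_Noetherian R S A \<and> u_S_Noetherian R S C"
    then show "u_S_Noetherian R S B"
      using u_S_Noetherian_extension[OF assms(2) f g _ _ s2] by simp
  qed
qed

end
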